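(* Let $\mu,\kappa$ be integers with $2\leq\kappa\leq\mu-2$, and consider the gradient field $W_{\mu,\kappa}$ on $X_{\mu,\kappa}=\operatorname{DConf}(\Delta^{\mu-1,\mu-\kappa-1},2)$. Write cells as $(A,B)$ with $A=\{a_1<\cdots<a_r\}$ and $B=\{b_1<\cdots<b_s\}$. The redundant cells $(A,B)$ associated to the directed edges of $W_{\mu,\kappa}$ belonging to the four families (E1)–(E4) described in the context fall in one of the following cases, where cases (i), (ii), (iii), (iv) correspond, respectively, to the families (E1), (E2), (E3), (E4): (i) If $s<\mu-\kappa$ and $\langle b_s+1,\mu\rangle\not\subseteq A$, then $(A,B)\nearrow(A,B)+_2\max\left(\langle b_s+1,\mu\rangle-A\right)$ is a directed edge in $W_{\mu,\kappa}$. (ii) If $r<\mu-\kappa$, $s=1$, $1\leq b_1-1\notin A$ and $\langle b_1+1,\mu\rangle\subseteq A$, then $(A,B)\nearrow(A,B)+_1(b_1-1)$ is a directed edge in $W_{\mu,\kappa}$. (iii) If $r<\mu-\kappa=s$, $a_r<\mu$ and $\langle b_s+1,\mu-1\rangle\not\subseteq A$, then $(A,B)\nearrow(A,B)+_1\mu$ is a directed edge in $W_{\mu,\kappa}$. (Note that in this case $\langle b_s+1,\mu\rangle\not\subseteq A$.) (iv) If $r<\mu-\kappa=s$, $\max\{a_r,b_s\}<\mu$, $\langle b_s+1,\mu-1\rangle\subseteq A$, $\langle1,b_s-1\rangle\not\subseteq B$ and $\overline{a}:=\max\left(\langle1,b_s-1\rangle-B\right)\notin A$, then $(A,B)\nearrow(A,B)+_1\overline{a}$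 is a directed edge in $W_{\mu,\kappa}$. (Note that in this case $\langle b_s+1,\mu\rangle\not\subseteq A$.)
   Context: For integers $p,q$, $\langle p,q\rangle=\{p,p+1,\ldots,q\}$, empty if $p>q$. $\Delta^{\mu-1,\mu-\kappa-1}$ is the $(\mu-\kappa-1)$-skeleton of the simplex with vertex set $\{1,2,\ldots,\mu\}$. $X=X_{\mu,\kappa}=\operatorname{DConf}(\Delta^{\mu-1,\mu-\kappa-1},2)$ is the subcomplex of the product cell complex of two copies of this skeleton consisting of products of two simplices with disjoint vertex sets. Its cells are the ordered pairs $(A,B)$ of disjoint nonempty subsets of $\{1,\ldots,\mu\}$, each of cardinality at most $\mu-\kappa$; the cell $(A,B)$ has dimension $|A|+|B|-2$, and faces are given by coordinatewise inclusion. For a cell $\alpha=(A,B)$ and $u\notin A\cup B$, put $\alpha+_1u=(A\cup\{u\},B)$ and $\alpha+_2u=(A,B\cup\{u\})$, whenever the result is a cell of $X$. Likewise $\alpha-_1u=(A-\{u\},B)$ for $u\in A$ and $\alpha-_2u=(A,B-\{u\})$ for $u\in B$, whenever the result is a cell of $X$. Order on cells: simplices (vertex sets written as increasing lists) are ordered by dimension first and lexicographically within the same dimension; cells $(A,B)$ are ordered lexicographically over the two coordinates. Construction of $W=W_{\mu,\kappa}$: initialize $W:=\varnothing$ and, for each $p$, let $A^p$ be the set of all $p$-dimensional cells of $X$. For $p=\dim X-1,\ldots,1,0$ (in that order), provided $A^p$ and $A^{p+1}$ are currently nonempty, do: for $j=2,1$ (in that order); for $u=\mu,\mu-1,\ldots,1$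 (in that order); for $\alpha$ running through the current $A^p$ in increasing order: if $\alpha+_ju$ is defined and currently $(\alpha,\alpha+_ju)\in A^p\times A^{p+1}$, add the directed edge $\alpha\nearrow\alpha+_ju$ to $W$, and remove $\alpha$ from $A^p$ and $\alpha+_ju$ from $A^{p+1}$. For a directed edge $\alpha\nearrow\beta$ in the final $W$, $\alpha$ is called redundant and $\beta$ collapsible. The four families of directed edges of $W_{\mu,\kappa}$ are described in terms of their collapsible cells $(A',B')$, with $A'=\{a'_1<\cdots<a'_{r'}\}$ and $B'=\{b'_1<\cdots<b'_{s'}\}$: (E1) $(A',B')-_2b'_{s'}\nearrow(A',B')$, where $s'>1$ and $\langle b'_{s'}+1,\mu\rangle\subseteq A'$. (E2) $(A',B')-_1(b'_1-1)\nearrow(A',B')$, where $r'>1$, $s'=1$, $\langle b'_1+1,\mu\rangle\subseteq A'$ and $b'_1-1\in A'$. (E3) $(A',B')-_1\mu\nearrow(A',B')$, where $r'>1$, $s'=\mu-\kappa$, $\langle b'_{s'}+1,\mu\rangle\not\subseteq A'$ and $a'_{r'}=\mu$. (E4) $(A',B')-_1\overline{a}\nearrow(A',B')$, where $r'>1$, $s'=\mu-\kappa$, $\langle b'_{s'}+1,\mu\rangle\not\subseteq A'$, $a'_{r'}<\mu$, $\langle b'_{s'}+1,\mu-1\rangle\subseteq A'$, $\langle1,b'_{s'}-1\rangle\not\subseteq B'$ and $\overline{a}:=\max\left(\langle1,b'_{s'}-1\rangle-B'\right)\in A'$. The redundant cell associated to such a directed edge is its source (the cell on the left of the arrow). *)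

theory Defs
  imports
    Complex_Main
    "HOL-Library.List_Lenlexorder"
    "HOL-Library.Product_Lexorder"
begin

text \<open>
  A cell is a pair of vertex sets.  For \<open>A = {a\<^sub>1 < \<dots> < a\<^sub>r}\<close> the numbers \<open>r\<close>, \<open>a\<^sub>1\<close> and \<open>a\<^sub>r\<close>
  are \<open>card A\<close>, \<open>Min A\<close> and \<open>Max A\<close>; the integer interval from \<open>p\<close> to \<open>q\<close> is \<open>{p..q}\<close>.
\<close>

type_synonym cell = "nat set \<times> nat set"

definition simplex_skeleton :: "nat \<Rightarrow> nat \<Rightarrow> nat set set" where
  "simplex_skeleton n d = {S. S \<subseteq> {1..n} \<and> S \<noteq> {} \<and> card S \<le> d + 1}"

definition dconf2 :: "nat set set \<Rightarrow> cell set" where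
  "dconf2 K = {(A, B). A \<in> K \<and> B \<in> K \<and> A \<inter> B = {}}"

definition X :: "nat \<Rightarrow> nat \<Rightarrow> cell set" where
  "X \<mu> \<kappa> = dconf2 (simplex_skeleton \<mu> (\<mu> - \<kappa> - 1))"

definition cell_dim :: "cell \<Rightarrow> nat" where
  "cell_dim \<alpha> = card (fst \<alpha>) + card (snd \<alpha>) - 2"

definition dim_X :: "nat \<Rightarrow> nat \<Rightarrow> nat" where
  "dim_X \<mu> \<kappa> = Max (cell_dim ` X \<mu> \<kappa>)"

text \<open>
  The following operations are total; whether \<open>\<alpha> +\<^sub>j u\<close> is defined is expressed separately
  by \<open>plus_defined\<close>.
\<close>

definition plus1 :: "cell \<Rightarrow> nat \<Rightarrow> cell" where
  "plus1 \<alpha> u = (insert u (fst \<alpha>), snd \<alpha>)"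

definition plus2 :: "cell \<Rightarrow> nat \<Rightarrow> cell" where
  "plus2 \<alpha> u = (fst \<alpha>, insert u (snd \<alpha>))"

definition minus1 :: "cell \<Rightarrow> nat \<Rightarrow> cell" where
  "minus1 \<alpha> u = (fst \<alpha> - {u}, snd \<alpha>)"

definition minus2 :: "cell \<Rightarrow> nat \<Rightarrow> cell" where
  "minus2 \<alpha> u = (fst \<alpha>, snd \<alpha> - {u})"

definition plus_defined ::
    "nat \<Rightarrow> nat \<Rightarrow> (cell \<Rightarrow> nat \<Rightarrow> cell) \<Rightarrow> cell \<Rightarrow> nat \<Rightarrow> bool" where
  "plus_defined \<mu> \<kappa> add \<alpha> u \<longleftrightarrow> u \<notin> fst \<alpha> \<union> snd \<alpha> \<and> add \<alpha> u \<in> X \<mu> \<kappa>"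

text \<open>
  On lists, \<open><\<close> is here the order by length first and lexicographically for equal lengths, and
  on pairs it is the lexicographic order.  Hence comparing keys is comparing cells
  lexicographically over the two coordinates, where simplices are compared by dimension first
  and then lexicographically.  On pairs of finite sets the key is injective, so that
  \<open>increasing_list\<close> enumerates a finite set of such pairs in increasing order.
\<close>

definition cell_key :: "cell \<Rightarrow> nat list \<times> nat list" where
  "cell_key \<alpha> = (sorted_list_of_set (fst \<alpha>), sorted_list_of_set (snd \<alpha>))"

definition increasing_list :: "cell set \<Rightarrow> cell list" where
  "increasing_list S = sorted_key_list_of_set cell_key S"

text \<open>
  A state of the construction consists of the edges added to \<open>W\<close> so far and of the current sets
  \<open>A\<^sup>p\<close>.  An edge from \<open>\<alpha>\<close> up to \<open>\<beta>\<close> is the pair \<open>(\<alpha>, \<beta>)\<close>.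
\<close>

type_synonym state = "(cell \<times> cell) set \<times> (nat \<Rightarrow> cell set)"

definition edge_step ::
    "nat \<Rightarrow> nat \<Rightarrow> nat \<Rightarrow> (cell \<Rightarrow> nat \<Rightarrow> cell) \<Rightarrow> nat \<Rightarrow> cell \<Rightarrow> state \<Rightarrow> state" where
  "edge_step \<mu> \<kappa> p add u \<alpha> = (\<lambda>(W, \<A>).
     if plus_defined \<mu> \<kappa> add \<alpha> u \<and> \<alpha> \<in> \<A> p \<and> add \<alpha> u \<in> \<A> (p + 1)
     then (insert (\<alpha>, add \<alpha> u) W,
           \<A>(p := \<A> p - {\<alpha>}, p + 1 := \<A> (p + 1) - {add \<alpha> u}))
     else (W, \<A>))"

definition vertex_step ::
    "nat \<Rightarrow> nat \<Rightarrow> nat \<Rightarrow> (cell \<Rightarrow> nat \<Rightarrow> cell) \<Rightarrow> nat \<Rightarrow> state \<Rightarrow> state" where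
  "vertex_step \<mu> \<kappa> p add u st =
     fold (edge_step \<mu> \<kappa> p add u) (increasing_list (snd st p)) st"

definition coordinate_step ::
    "nat \<Rightarrow> nat \<Rightarrow> nat \<Rightarrow> (cell \<Rightarrow> nat \<Rightarrow> cell) \<Rightarrow> state \<Rightarrow> state" where
  "coordinate_step \<mu> \<kappa> p add st = fold (vertex_step \<mu> \<kappa> p add) (rev [1..<\<mu> + 1]) st"

definition dimension_step :: "nat \<Rightarrow> nat \<Rightarrow> nat \<Rightarrow> state \<Rightarrow> state" where
  "dimension_step \<mu> \<kappa> p st =
     (if snd st p \<noteq> {} \<and> snd st (p + 1) \<noteq> {}
      then fold (coordinate_step \<mu> \<kappa> p) [plus2, plus1] st
      else st)"

definition W :: "nat \<Rightarrow> nat \<Rightarrow> (cell \<times> cell) set" where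
  "W \<mu> \<kappa> = fst (fold (dimension_step \<mu> \<kappa>) (rev [0..<dim_X \<mu> \<kappa>])
                   ({}, \<lambda>p. {\<alpha> \<in> X \<mu> \<kappa>. cell_dim \<alpha> = p}))"

definition redundant_cells :: "(cell \<times> cell) set \<Rightarrow> cell set" where
  "redundant_cells F = {\<alpha>. \<exists>\<beta>. (\<alpha>, \<beta>) \<in> F}"

definition E1 :: "nat \<Rightarrow> nat \<Rightarrow> (cell \<times> cell) set" where
  "E1 \<mu> \<kappa> = {(minus2 (A, B) (Max B), (A, B)) | A B.
     (A, B) \<in> X \<mu> \<kappa> \<and> card B > 1 \<and> {Max B + 1..\<mu>} \<subseteq> A}"

definition E2 :: "nat \<Rightarrow> nat \<Rightarrow> (cell \<times> cell) set" where
  "E2 \<mu> \<kappa> = {(minus1 (A, B) (Min B - 1), (A, B)) | A B.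
     (A, B) \<in> X \<mu> \<kappa> \<and> card A > 1 \<and> card B = 1 \<and> {Min B + 1..\<mu>} \<subseteq> A \<and> Min B - 1 \<in> A}"

definition E3 :: "nat \<Rightarrow> nat \<Rightarrow> (cell \<times> cell) set" where
  "E3 \<mu> \<kappa> = {(minus1 (A, B) \<mu>, (A, B)) | A B.
     (A, B) \<in> X \<mu> \<kappa> \<and> card A > 1 \<and> card B = \<mu> - \<kappa> \<and>
     \<not> {Max B + 1..\<mu>} \<subseteq> A \<and> Max A = \<mu>}"

definition E4 :: "nat \<Rightarrow> nat \<Rightarrow> (cell \<times> cell) set" where
  "E4 \<mu> \<kappa> = {(minus1 (A, B) (Max ({1..Max B - 1} - B)), (A, B)) | A B.
     (A, B) \<in> X \<mu> \<kappa> \<and> card A > 1 \<and> card B = \<mu> - \<kappa> \<and>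
     \<not> {Max B + 1..\<mu>} \<subseteq> A \<and> Max A < \<mu> \<and> {Max B + 1..\<mu> - 1} \<subseteq> A \<and>
     \<not> {1..Max B - 1} \<subseteq> B \<and> Max ({1..Max B - 1} - B) \<in> A}"

definition case_i :: "nat \<Rightarrow> nat \<Rightarrow> cell \<Rightarrow> bool" where
  "case_i \<mu> \<kappa> = (\<lambda>(A, B). card B < \<mu> - \<kappa> \<and> \<not> {Max B + 1..\<mu>} \<subseteq> A)"

definition case_ii :: "nat \<Rightarrow> nat \<Rightarrow> cell \<Rightarrow> bool" where
  "case_ii \<mu> \<kappa> = (\<lambda>(A, B). card A < \<mu> - \<kappa> \<and> card B = 1 \<and>
     1 \<le> Min B - 1 \<and> Min B - 1 \<notin> A \<and> {Min B + 1..\<mu>} \<subseteq> A)"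

definition case_iii :: "nat \<Rightarrow> nat \<Rightarrow> cell \<Rightarrow> bool" where
  "case_iii \<mu> \<kappa> = (\<lambda>(A, B). card A < \<mu> - \<kappa> \<and> card B = \<mu> - \<kappa> \<and>
     Max A < \<mu> \<and> \<not> {Max B + 1..\<mu> - 1} \<subseteq> A)"

definition case_iv :: "nat \<Rightarrow> nat \<Rightarrow> cell \<Rightarrow> bool" where
  "case_iv \<mu> \<kappa> = (\<lambda>(A, B). card A < \<mu> - \<kappa> \<and> card B = \<mu> - \<kappa> \<and>
     max (Max A) (Max B) < \<mu> \<and> {Max B + 1..\<mu> - 1} \<subseteq> A \<and>
     \<not> {1..Max B - 1} \<subseteq> B \<and> Max ({1..Max B - 1} - B) \<notin> A)"

end

theory Submission
  imports Defs
begin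

text \<open>
  Call \<open>(j, u)\<close> a stage of the construction; the stage of an edge from \<open>\<alpha>\<close> up to \<open>\<alpha> +\<^sub>j u\<close> is
  \<open>(j, u)\<close>.  Cases (i)--(iv) predict a set of edges, each with its stage, which is also the set
  of edges in (E1)--(E4).  No cell lies on two predicted edges.  The greedy construction finds
  exactly the predicted edges because of one observation: if \<open>\<beta> = \<alpha> +\<^sub>j u\<close> is not the source of
  a predicted edge, and the edge from \<open>\<alpha>\<close> to \<open>\<beta>\<close> is not predicted, then \<open>\<alpha>\<close> is the source or
  \<open>\<beta>\<close> is the target of a predicted edge of an earlier stage, so that one of them is gone
  before \<open>(j, u)\<close>.  Predicted sources of dimension \<open>p + 1\<close> have already been removed in the
  preceding dimension step.
\<close>

section \<open>Stages and the edges predicted for them\<close>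

text \<open>The coordinate \<open>j = 2\<close> is encoded as \<^term>\<open>True\<close> and \<open>j = 1\<close> as \<^term>\<open>False\<close>.\<close>

fun add_coord :: "bool \<Rightarrow> cell \<Rightarrow> nat \<Rightarrow> cell" where
  "add_coord True = plus2"
| "add_coord False = plus1"

text \<open>The stages handled strictly earlier than \<open>(j, u)\<close>: coordinate 2 precedes
  coordinate 1, and vertices are visited downwards, hence \<open>u < u'\<close>.\<close>

definition before :: "bool \<Rightarrow> nat \<Rightarrow> (bool \<times> nat) set" where
  "before j u = {(j', u'). j' \<and> \<not> j \<or> j' = j \<and> u < u'}"

text \<open>Sources are described by the cases and targets by the families, so that the agreement of
  the two descriptions is what \<open>source_at_edge\<close> and \<open>target_at_edge\<close>
  prove.\<close>

definition source_at :: "nat \<Rightarrow> nat \<Rightarrow> bool \<Rightarrow> nat \<Rightarrow> cell \<Rightarrow> bool" where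
  "source_at \<mu> \<kappa> j u = (\<lambda>(A, B). (A, B) \<in> X \<mu> \<kappa> \<and>
     (if j then case_i \<mu> \<kappa> (A, B) \<and> u = Max ({Max B + 1..\<mu>} - A)
      else case_ii \<mu> \<kappa> (A, B) \<and> u = Min B - 1 \<or>
           case_iii \<mu> \<kappa> (A, B) \<and> u = \<mu> \<or>
           case_iv \<mu> \<kappa> (A, B) \<and> u = Max ({1..Max B - 1} - B)))"

definition target_at :: "nat \<Rightarrow> nat \<Rightarrow> bool \<Rightarrow> nat \<Rightarrow> cell \<Rightarrow> bool" where
  "target_at \<mu> \<kappa> j u = (\<lambda>(A, B).
     (if j then (minus2 (A, B) u, (A, B)) \<in> E1 \<mu> \<kappa> \<and> u = Max B
      else (minus1 (A, B) u, (A, B)) \<in> E2 \<mu> \<kappa> \<and> u = Min B - 1 \<or>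
           (minus1 (A, B) u, (A, B)) \<in> E3 \<mu> \<kappa> \<and> u = \<mu> \<or>
           (minus1 (A, B) u, (A, B)) \<in> E4 \<mu> \<kappa> \<and> u = Max ({1..Max B - 1} - B)))"

lemma E1_iff:
  "(\<alpha>, (A, B)) \<in> E1 \<mu> \<kappa> \<longleftrightarrow> \<alpha> = minus2 (A, B) (Max B) \<and>
     (A, B) \<in> X \<mu> \<kappa> \<and> card B > 1 \<and> {Max B + 1..\<mu>} \<subseteq> A"
  by (auto simp: E1_def)

lemma E2_iff:
  "(\<alpha>, (A, B)) \<in> E2 \<mu> \<kappa> \<longleftrightarrow> \<alpha> = minus1 (A, B) (Min B - 1) \<and>
     (A, B) \<in> X \<mu> \<kappa> \<and> card A > 1 \<and> card B = 1 \<and> {Min B + 1..\<mu>} \<subseteq> A \<and> Min B - 1 \<in> A"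
  by (auto simp: E2_def)

lemma E3_iff:
  "(\<alpha>, (A, B)) \<in> E3 \<mu> \<kappa> \<longleftrightarrow> \<alpha> = minus1 (A, B) \<mu> \<and>
     (A, B) \<in> X \<mu> \<kappa> \<and> card A > 1 \<and> card B = \<mu> - \<kappa> \<and>
     \<not> {Max B + 1..\<mu>} \<subseteq> A \<and> Max A = \<mu>"
  by (auto simp: E3_def)

lemma E4_iff:
  "(\<alpha>, (A, B)) \<in> E4 \<mu> \<kappa> \<longleftrightarrow> \<alpha> = minus1 (A, B) (Max ({1..Max B - 1} - B)) \<and>
     (A, B) \<in> X \<mu> \<kappa> \<and> card A > 1 \<and> card B = \<mu> - \<kappa> \<and>
     \<not> {Max B + 1..\<mu>} \<subseteq> A \<and> Max A < \<mu> \<and> {Max B + 1..\<mu> - 1} \<subseteq> A \<and>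
     \<not> {1..Max B - 1} \<subseteq> B \<and> Max ({1..Max B - 1} - B) \<in> A"
  by (auto simp: E4_def)

section \<open>Cells and their enumeration\<close>

text \<open>Truncated subtraction makes \<open>(\<mu> - \<kappa> - 1) + 1\<close> equal to
  \<open>\<mu> - \<kappa>\<close> only when \<open>\<kappa> < \<mu>\<close>.\<close>

lemma X_iff:
  assumes "\<kappa> < \<mu>"
  shows "(A, B) \<in> X \<mu> \<kappa> \<longleftrightarrow> A \<subseteq> {1..\<mu>} \<and> A \<noteq> {} \<and> card A \<le> \<mu> - \<kappa> \<and>
     B \<subseteq> {1..\<mu>} \<and> B \<noteq> {} \<and> card B \<le> \<mu> - \<kappa> \<and> A \<inter> B = {}"
  using assms by (auto simp: X_def dconf2_def simplex_skeleton_def)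

lemma finite_X: "finite (X \<mu> \<kappa>)"
proof (rule finite_subset)
  show "X \<mu> \<kappa> \<subseteq> Pow {1..\<mu>} \<times> Pow {1..\<mu>}"
    by (auto simp: X_def dconf2_def simplex_skeleton_def)
qed auto

lemma finite_X_coords:
  assumes "(A, B) \<in> X \<mu> \<kappa>"
  shows "finite A" "finite B"
  using assms by (auto simp: X_def dconf2_def simplex_skeleton_def intro: finite_subset)

lemma (in linorder) set_sorted_key_list_of_set:
  assumes "inj_on f S" "finite S"
  shows "set (sorted_key_list_of_set f S) = S"
proof -
  interpret folding_insort_key "(\<le>)" "(<)" S f
    by unfold_locales fact
  show ?thesis
    using assms(2) by simp
qed

text \<open>A finite set is recovered from its sorted list, so \<open>cell_key\<close> is injective
  on cells. This is the only property of the enumeration that the proof uses.\<close>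

lemma set_increasing_list:
  assumes "S \<subseteq> X \<mu> \<kappa>"
  shows "set (increasing_list S) = S"
proof -
  have "inj_on cell_key (X \<mu> \<kappa>)"
    by (intro inj_onI)
       (metis cell_key_def finite_X_coords prod.collapse prod.inject set_sorted_list_of_set)
  then have "inj_on cell_key S"
    using assms by (rule inj_on_subset)
  moreover have "finite S"
    using assms finite_X by (rule finite_subset)
  ultimately show ?thesis
    unfolding increasing_list_def by (rule set_sorted_key_list_of_set)
qed

text \<open>Since \<open>u\<close> lies in neither of the two smaller cells, deleting it from
  coordinate \<open>j\<close> undoes the addition.\<close>

lemma add_coord_inj:
  assumes "plus_defined \<mu> \<kappa> (add_coord j) \<alpha> u" "plus_defined \<mu> \<kappa> (add_coord j) \<alpha>' u"
    and "add_coord j \<alpha> u = add_coord j \<alpha>' u"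
  shows "\<alpha> = \<alpha>'"
  using assms
  by (cases j; cases \<alpha>; cases \<alpha>') (auto simp: plus_defined_def plus1_def plus2_def)

text \<open>Both coordinates are nonempty, so the truncated subtraction of 2 in
  \<open>cell_dim\<close> is exact.\<close>

lemma cell_dim_add_coord:
  assumes "\<kappa> < \<mu>" "\<alpha> \<in> X \<mu> \<kappa>" "plus_defined \<mu> \<kappa> (add_coord j) \<alpha> u"
  shows "cell_dim (add_coord j \<alpha> u) = Suc (cell_dim \<alpha>)"
proof -
  obtain A B where \<alpha>: "\<alpha> = (A, B)"
    by (cases \<alpha>)
  have fin: "finite A" "finite B"
    using assms \<alpha> finite_X_coords by auto
  then have "card A > 0" "card B > 0"
    using assms \<alpha> by (auto simp: X_iff card_gt_0_iff)
  then show ?thesis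
    using assms fin \<alpha>
    by (cases j) (auto simp: plus_defined_def plus1_def plus2_def cell_dim_def)
qed

section \<open>One vertex step as a simultaneous matching\<close>

definition matched :: "nat \<Rightarrow> nat \<Rightarrow> nat \<Rightarrow> bool \<Rightarrow> nat \<Rightarrow> (nat \<Rightarrow> cell set) \<Rightarrow> cell set" where
  "matched \<mu> \<kappa> p j u \<A> =
     {\<alpha> \<in> \<A> p. plus_defined \<mu> \<kappa> (add_coord j) \<alpha> u \<and> add_coord j \<alpha> u \<in> \<A> (p + 1)}"

text \<open>The candidates can be read off the initial state, because handling one of them leaves
  all others intact.\<close>

lemma fold_edge_step:
  "fold (edge_step \<mu> \<kappa> p (add_coord j) u) xs (W0, \<A>) =
     (let M = matched \<mu> \<kappa> p j u \<A> \<inter> set xs in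
       (W0 \<union> (\<lambda>\<alpha>. (\<alpha>, add_coord j \<alpha> u)) ` M,
        \<A>(p := \<A> p - M, p + 1 := \<A> (p + 1) - (\<lambda>\<alpha>. add_coord j \<alpha> u) ` M)))"
proof (induction xs arbitrary: W0 \<A>)
  case Nil
  show ?case
    by (simp only: Let_def list.set Int_empty_right image_empty Diff_empty Un_empty_right
        fun_upd_triv fold_simps id_apply)
next
  case (Cons x xs)
  show ?case
  proof (cases "x \<in> matched \<mu> \<kappa> p j u \<A>")
    case False
    then have "edge_step \<mu> \<kappa> p (add_coord j) u x (W0, \<A>) = (W0, \<A>)"
      by (auto simp: edge_step_def matched_def)
    then show ?thesis
      using False by (simp add: Cons.IH)
  next
    case True
    define \<B> where "\<B> = \<A>(p := \<A> p - {x}, p + 1 := \<A> (p + 1) - {add_coord j x u})"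
    have step: "edge_step \<mu> \<kappa> p (add_coord j) u x (W0, \<A>) =
        (insert (x, add_coord j x u) W0, \<B>)"
      using True by (auto simp: edge_step_def matched_def \<B>_def)
    \<comment> \<open>Deleting the partner of \<open>x\<close> from \<open>\<A> (p + 1)\<close>
      costs no other candidate its own partner.\<close>
    have "add_coord j y u \<noteq> add_coord j x u" if "y \<in> matched \<mu> \<kappa> p j u \<A>" "y \<noteq> x" for y
      using that True add_coord_inj[of \<mu> \<kappa> j y u x] by (auto simp: matched_def)
    then have "matched \<mu> \<kappa> p j u \<B> = matched \<mu> \<kappa> p j u \<A> - {x}"
      by (auto simp: matched_def \<B>_def)
    then have "matched \<mu> \<kappa> p j u \<A> \<inter> set (x # xs) = insert x (matched \<mu> \<kappa> p j u \<B> \<inter> set xs)"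
      using True by auto
    then show ?thesis
      by (simp only: fold_simps comp_apply step Cons.IH Let_def image_insert)
         (auto simp: \<B>_def fun_eq_iff)
  qed
qed

text \<open>
  Two edges of one vertex step are disjoint because adding \<open>u\<close> to a fixed coordinate is
  injective, so the order in which the cells are visited does not matter.
\<close>

lemma vertex_step_eq:
  assumes "\<A> p \<subseteq> X \<mu> \<kappa>"
  shows "vertex_step \<mu> \<kappa> p (add_coord j) u (W0, \<A>) =
     (let M = matched \<mu> \<kappa> p j u \<A> in
       (W0 \<union> (\<lambda>\<alpha>. (\<alpha>, add_coord j \<alpha> u)) ` M,
        \<A>(p := \<A> p - M, p + 1 := \<A> (p + 1) - (\<lambda>\<alpha>. add_coord j \<alpha> u) ` M)))"
proof -
  have "matched \<mu> \<kappa> p j u \<A> \<inter> \<A> p = matched \<mu> \<kappa> p j u \<A>"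
    by (auto simp: matched_def)
  then show ?thesis
    by (simp add: vertex_step_def fold_edge_step set_increasing_list[OF assms])
qed

subsection \<open>Edges of the four families\<close>

text \<open>The largest vertex above \<open>Max B\<close> missing from \<open>A\<close> becomes the
  new maximum of the second coordinate, and everything above it lies in \<open>A\<close>, as (E1)
  demands.\<close>

lemma case_i_E1:
  assumes "\<kappa> < \<mu>" "(A, B) \<in> X \<mu> \<kappa>" "case_i \<mu> \<kappa> (A, B)" and u: "u = Max ({Max B + 1..\<mu>} - A)"
  shows "u \<notin> A \<union> B" "plus2 (A, B) u \<in> X \<mu> \<kappa>" "((A, B), plus2 (A, B) u) \<in> E1 \<mu> \<kappa>"
    "Max (insert u B) = u"
proof -
  have fin: "finite A" "finite B"
    using assms finite_X_coords by auto
  have ne: "B \<noteq> {}"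
    using assms by (simp add: X_iff)
  have u_in: "u \<in> {Max B + 1..\<mu>} - A"
    unfolding u using assms(3) by (intro Max_in) (auto simp: case_i_def)
  have u_max: "x \<le> u" if "x \<in> {Max B + 1..\<mu>} - A" for x
    unfolding u using that by (intro Max_ge) auto
  show "Max (insert u B) = u"
    using u_in fin ne by (simp add: max_def)
  have "u \<notin> B"
  proof
    assume "u \<in> B"
    then have "u \<le> Max B"
      using fin by simp
    then show False
      using u_in by simp
  qed
  with u_in show notin: "u \<notin> A \<union> B"
    by auto
  show mem: "plus2 (A, B) u \<in> X \<mu> \<kappa>"
    using assms notin fin u_in by (auto simp: X_iff plus2_def case_i_def)
  have "{u + 1..\<mu>} \<subseteq> A"
  proof
    fix x
    assume "x \<in> {u + 1..\<mu>}"
    then show "x \<in> A"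
      using u_in u_max[of x] by auto
  qed
  moreover have "card B > 0"
    using fin ne by (simp add: card_gt_0_iff)
  ultimately show "((A, B), plus2 (A, B) u) \<in> E1 \<mu> \<kappa>"
    using mem notin fin \<open>Max (insert u B) = u\<close> by (auto simp: plus2_def minus2_def E1_iff)
qed

text \<open>\<open>Max B\<close> avoids \<open>A\<close> and exceeds the maximum left after its
  removal, while everything above it lies in \<open>A\<close>. It is therefore the largest missing
  vertex of the source, so the stage is recovered.\<close>

lemma E1_case_i:
  assumes "\<kappa> < \<mu>" "(\<alpha>, (A, B)) \<in> E1 \<mu> \<kappa>"
  shows "\<alpha> = (A, B - {Max B})" "\<alpha> \<in> X \<mu> \<kappa>" "case_i \<mu> \<kappa> \<alpha>"
    "Max B = Max ({Max (B - {Max B}) + 1..\<mu>} - A)" "Max B \<in> B"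
proof -
  have *: "(A, B) \<in> X \<mu> \<kappa>" "card B > 1" "{Max B + 1..\<mu>} \<subseteq> A"
    using assms by (auto simp: E1_iff)
  then have sub: "A \<subseteq> {1..\<mu>}" "B \<subseteq> {1..\<mu>}" "A \<noteq> {}" "B \<noteq> {}" "A \<inter> B = {}"
      "card A \<le> \<mu> - \<kappa>" "card B \<le> \<mu> - \<kappa>"
    using assms(1) by (auto simp: X_iff)
  have fin: "finite A" "finite B"
    using finite_X_coords *(1) by auto
  show \<alpha>: "\<alpha> = (A, B - {Max B})"
    using assms by (simp add: E1_iff minus2_def)
  show max_in: "Max B \<in> B"
    using fin sub by auto
  have card: "card (B - {Max B}) = card B - 1"
    using max_in fin by simp
  then have ne: "B - {Max B} \<noteq> {}"
    using * by (metis card.empty zero_less_diff less_irrefl)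
  show "\<alpha> \<in> X \<mu> \<kappa>"
    using assms sub ne card by (auto simp: X_iff \<alpha>)
  have "Max (B - {Max B}) \<in> B - {Max B}"
    using fin ne by (intro Max_in) auto
  then have less: "Max (B - {Max B}) < Max B"
    using fin by (simp add: order.not_eq_order_implies_strict)
  then have mem: "Max B \<in> {Max (B - {Max B}) + 1..\<mu>} - A"
    using max_in sub by auto
  then show "case_i \<mu> \<kappa> \<alpha>"
    using * sub card by (auto simp: case_i_def \<alpha>)
  show "Max B = Max ({Max (B - {Max B}) + 1..\<mu>} - A)"
    using mem *(3) by (intro Max_eqI[symmetric]) (auto simp: subset_iff not_less_eq_eq[symmetric])
qed

lemma case_ii_E2:
  assumes "\<kappa> < \<mu>" "(A, B) \<in> X \<mu> \<kappa>" "case_ii \<mu> \<kappa> (A, B)" and u: "u = Min B - 1"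
  shows "u \<notin> A \<union> B" "plus1 (A, B) u \<in> X \<mu> \<kappa>" "((A, B), plus1 (A, B) u) \<in> E2 \<mu> \<kappa>"
proof -
  have fin: "finite A" "finite B"
    using assms finite_X_coords by auto
  obtain b where B: "B = {b}"
    using assms(3) by (auto simp: case_ii_def card_1_singleton_iff)
  have card: "card A > 0"
    using assms fin by (simp add: X_iff card_gt_0_iff)
  show notin: "u \<notin> A \<union> B"
    using assms(3) by (auto simp: case_ii_def u B)
  \<comment> \<open>On naturals \<open>1 \<le> b - 1\<close> forces \<open>2 \<le> b\<close>, so
    \<open>b - 1\<close> is a true predecessor and a vertex.\<close>
  have b: "2 \<le> b" "b \<le> \<mu>"
    using assms by (auto simp: case_ii_def B X_iff)
  show mem: "plus1 (A, B) u \<in> X \<mu> \<kappa>"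
    using assms notin fin b by (auto simp: X_iff plus1_def case_ii_def B)
  show "((A, B), plus1 (A, B) u) \<in> E2 \<mu> \<kappa>"
    using mem notin fin card assms(3) by (auto simp: plus1_def minus1_def E2_iff case_ii_def u B)
qed

lemma E2_case_ii:
  assumes "\<kappa> < \<mu>" "(\<alpha>, (A, B)) \<in> E2 \<mu> \<kappa>"
  shows "\<alpha> = (A - {Min B - 1}, B)" "\<alpha> \<in> X \<mu> \<kappa>" "case_ii \<mu> \<kappa> \<alpha>" "Min B - 1 \<in> A"
proof -
  have *: "(A, B) \<in> X \<mu> \<kappa>" "card A > 1" "card B = 1" "{Min B + 1..\<mu>} \<subseteq> A" "Min B - 1 \<in> A"
    using assms by (auto simp: E2_iff)
  then have sub: "A \<subseteq> {1..\<mu>}" "B \<subseteq> {1..\<mu>}" "A \<noteq> {}" "B \<noteq> {}" "A \<inter> B = {}"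
      "card A \<le> \<mu> - \<kappa>" "card B \<le> \<mu> - \<kappa>"
    using assms(1) by (auto simp: X_iff)
  have fin: "finite A" "finite B"
    using finite_X_coords *(1) by auto
  show \<alpha>: "\<alpha> = (A - {Min B - 1}, B)"
    using assms by (simp add: E2_iff minus1_def)
  have card: "card (A - {Min B - 1}) = card A - 1"
    using * fin by simp
  then have ne: "A - {Min B - 1} \<noteq> {}"
    using * by (metis card.empty zero_less_diff less_irrefl)
  show "\<alpha> \<in> X \<mu> \<kappa>"
    using assms sub ne card by (auto simp: X_iff \<alpha>)
  show "case_ii \<mu> \<kappa> \<alpha>"
    using * sub card by (fastforce simp: case_ii_def \<alpha>)
  show "Min B - 1 \<in> A" by fact
qed

text \<open>A vertex below \<open>\<mu>\<close> that \<open>A\<close> misses above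
  \<open>Max B\<close> is still missed after \<open>\<mu>\<close> is added. Its existence also
  forces \<open>Max B < \<mu>\<close>.\<close>

lemma case_iii_E3:
  assumes "\<kappa> < \<mu>" "(A, B) \<in> X \<mu> \<kappa>" "case_iii \<mu> \<kappa> (A, B)"
  shows "\<mu> \<notin> A \<union> B" "plus1 (A, B) \<mu> \<in> X \<mu> \<kappa>" "((A, B), plus1 (A, B) \<mu>) \<in> E3 \<mu> \<kappa>"
    "\<not> {Max B + 1..\<mu>} \<subseteq> A"
proof -
  have fin: "finite A" "finite B"
    using assms finite_X_coords by auto
  have sub: "A \<subseteq> {1..\<mu>}" "B \<subseteq> {1..\<mu>}" "A \<noteq> {}" "B \<noteq> {}"
    using assms by (auto simp: X_iff)
  have card: "card A > 0"
    using fin sub by (simp add: card_gt_0_iff)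
  have **: "card A < \<mu> - \<kappa>" "card B = \<mu> - \<kappa>" "Max A < \<mu>" "\<not> {Max B + 1..\<mu> - 1} \<subseteq> A"
    using assms(3) by (auto simp: case_iii_def)
  have "\<mu> \<notin> A"
    using fin ** Max_ge leD by blast
  have "Max B < \<mu>"
    using **(4) by (auto simp: subset_iff)
  then have "\<mu> \<notin> B"
    using fin Max_ge leD by blast
  then show notin: "\<mu> \<notin> A \<union> B"
    using \<open>\<mu> \<notin> A\<close> by simp
  show mem: "plus1 (A, B) \<mu> \<in> X \<mu> \<kappa>"
    using assms notin fin ** by (auto simp: X_iff plus1_def)
  have "\<not> {Max B + 1..\<mu>} \<subseteq> insert \<mu> A"
    using ** by (fastforce simp: subset_iff)
  moreover have "Max (insert \<mu> A) = \<mu>"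
    using fin sub **(3) by simp
  ultimately show "((A, B), plus1 (A, B) \<mu>) \<in> E3 \<mu> \<kappa>"
    using mem notin fin card **(2) by (simp add: plus1_def minus1_def E3_iff)
  show "\<not> {Max B + 1..\<mu>} \<subseteq> A"
    using \<open>\<not> {Max B + 1..\<mu>} \<subseteq> insert \<mu> A\<close> by blast
qed

text \<open>As \<open>\<mu>\<close> lies in \<open>A\<close>, the vertex missing above
  \<open>Max B\<close> lies below \<open>\<mu>\<close>, which gives the sharper non-inclusion of
  case (iii).\<close>

lemma E3_case_iii:
  assumes "\<kappa> < \<mu>" "(\<alpha>, (A, B)) \<in> E3 \<mu> \<kappa>"
  shows "\<alpha> = (A - {\<mu>}, B)" "\<alpha> \<in> X \<mu> \<kappa>" "case_iii \<mu> \<kappa> \<alpha>" "\<mu> \<in> A"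
proof -
  have *: "(A, B) \<in> X \<mu> \<kappa>" "card A > 1" "card B = \<mu> - \<kappa>" "\<not> {Max B + 1..\<mu>} \<subseteq> A" "Max A = \<mu>"
    using assms by (auto simp: E3_iff)
  then have sub: "A \<subseteq> {1..\<mu>}" "B \<subseteq> {1..\<mu>}" "A \<noteq> {}" "B \<noteq> {}" "A \<inter> B = {}"
      "card A \<le> \<mu> - \<kappa>" "card B \<le> \<mu> - \<kappa>"
    using assms(1) by (auto simp: X_iff)
  have fin: "finite A" "finite B"
    using finite_X_coords *(1) by auto
  show \<alpha>: "\<alpha> = (A - {\<mu>}, B)"
    using assms by (simp add: E3_iff minus1_def)
  show \<mu>: "\<mu> \<in> A"
    using * fin sub Max_in by metis
  have card: "card (A - {\<mu>}) = card A - 1"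
    using \<mu> fin by simp
  then have ne: "A - {\<mu>} \<noteq> {}"
    using * by (metis card.empty zero_less_diff less_irrefl)
  show "\<alpha> \<in> X \<mu> \<kappa>"
    using assms sub ne card by (auto simp: X_iff \<alpha>)
  have "Max (A - {\<mu>}) \<in> A - {\<mu>}"
    using fin ne by (intro Max_in) auto
  then have "Max (A - {\<mu>}) < \<mu>"
    using sub by (auto simp: order.not_eq_order_implies_strict)
  moreover have "\<not> {Max B + 1..\<mu> - 1} \<subseteq> A - {\<mu>}"
  proof -
    obtain x where "x \<in> {Max B + 1..\<mu>}" "x \<notin> A"
      using *(4) by blast
    moreover from this \<mu> have "x \<noteq> \<mu>"
      by blast
    ultimately show ?thesis
      by (auto simp: subset_iff intro!: exI[of _ x])
  qed
  ultimately show "case_iii \<mu> \<kappa> \<alpha>"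
    using * sub card by (auto simp: case_iii_def \<alpha>)
qed

text \<open>The added vertex lies below \<open>Max B\<close>, so nothing changes above
  \<open>Max B\<close>, where \<open>\<mu>\<close> remains the only vertex missing.\<close>

lemma case_iv_E4:
  assumes "\<kappa> < \<mu>" "(A, B) \<in> X \<mu> \<kappa>" "case_iv \<mu> \<kappa> (A, B)" and u: "u = Max ({1..Max B - 1} - B)"
  shows "u \<notin> A \<union> B" "plus1 (A, B) u \<in> X \<mu> \<kappa>" "((A, B), plus1 (A, B) u) \<in> E4 \<mu> \<kappa>"
    "\<not> {Max B + 1..\<mu>} \<subseteq> A"
proof -
  have fin: "finite A" "finite B"
    using assms finite_X_coords by auto
  have sub: "A \<subseteq> {1..\<mu>}" "B \<subseteq> {1..\<mu>}" "A \<noteq> {}" "B \<noteq> {}"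
    using assms by (auto simp: X_iff)
  have card: "card A > 0"
    using fin sub by (simp add: card_gt_0_iff)
  have **: "card A < \<mu> - \<kappa>" "card B = \<mu> - \<kappa>" "Max A < \<mu>" "Max B < \<mu>" "{Max B + 1..\<mu> - 1} \<subseteq> A"
      "\<not> {1..Max B - 1} \<subseteq> B" "u \<notin> A"
    using assms(3) by (auto simp: case_iv_def u)
  have u_in: "u \<in> {1..Max B - 1} - B"
    unfolding u using ** by (intro Max_in) auto
  then show notin: "u \<notin> A \<union> B"
    using ** by simp
  have u_less: "u < \<mu>"
    using u_in ** by auto
  then show mem: "plus1 (A, B) u \<in> X \<mu> \<kappa>"
    using assms(1,2) notin fin **(1) u_in by (simp add: X_iff plus1_def)
  have "\<mu> \<notin> A"
    using fin ** Max_ge leD by blast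
  moreover have "\<mu> \<in> {Max B + 1..\<mu>}"
    using ** by simp
  ultimately have "\<not> {Max B + 1..\<mu>} \<subseteq> insert u A"
    using u_less by blast
  moreover have "Max (insert u A) < \<mu>"
    using u_less ** fin sub by simp
  ultimately show "((A, B), plus1 (A, B) u) \<in> E4 \<mu> \<kappa>"
    using mem notin fin card ** unfolding plus1_def minus1_def E4_iff fst_conv snd_conv u[symmetric]
    by auto
  show "\<not> {Max B + 1..\<mu>} \<subseteq> A"
    using \<open>\<not> {Max B + 1..\<mu>} \<subseteq> insert u A\<close> by blast
qed

text \<open>Removing a vertex below \<open>Max B\<close> keeps \<open>{Max B + 1..\<mu> - 1}\<close>
  covered and cannot raise the maximum of \<open>A\<close>; \<open>Max B < \<mu>\<close> because an
  empty interval would be covered.\<close>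

lemma E4_case_iv:
  assumes "\<kappa> < \<mu>" "(\<alpha>, (A, B)) \<in> E4 \<mu> \<kappa>" and u: "u = Max ({1..Max B - 1} - B)"
  shows "\<alpha> = (A - {u}, B)" "\<alpha> \<in> X \<mu> \<kappa>" "case_iv \<mu> \<kappa> \<alpha>" "u \<in> A"
proof -
  have *: "(A, B) \<in> X \<mu> \<kappa>" "card A > 1" "card B = \<mu> - \<kappa>" "\<not> {Max B + 1..\<mu>} \<subseteq> A" "Max A < \<mu>"
    "{Max B + 1..\<mu> - 1} \<subseteq> A" "\<not> {1..Max B - 1} \<subseteq> B" "u \<in> A"
    using assms by (auto simp: E4_iff)
  then have sub: "A \<subseteq> {1..\<mu>}" "B \<subseteq> {1..\<mu>}" "A \<noteq> {}" "B \<noteq> {}" "A \<inter> B = {}"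
      "card A \<le> \<mu> - \<kappa>" "card B \<le> \<mu> - \<kappa>"
    using assms(1) by (auto simp: X_iff)
  have fin: "finite A" "finite B"
    using finite_X_coords *(1) by auto
  show \<alpha>: "\<alpha> = (A - {u}, B)"
    using assms by (simp add: E4_iff minus1_def)
  have card: "card (A - {u}) = card A - 1"
    using * fin by simp
  then have ne: "A - {u} \<noteq> {}"
    using * by (metis card.empty zero_less_diff less_irrefl)
  show "\<alpha> \<in> X \<mu> \<kappa>"
    using assms sub ne card by (auto simp: X_iff \<alpha>)
  have "u \<in> {1..Max B - 1} - B"
    unfolding u using * by (intro Max_in) auto
  then have u_less: "u < Max B"
    by auto
  have "Max (A - {u}) \<le> Max A"
    using fin ne by (intro Max_mono) auto
  then have "Max (A - {u}) < \<mu>"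
    using * by simp
  moreover have "Max B < \<mu>"
    using *(4) by (auto simp: subset_iff)
  moreover have "{Max B + 1..\<mu> - 1} \<subseteq> A - {u}"
    using * u_less by auto
  ultimately show "case_iv \<mu> \<kappa> \<alpha>"
    using * card sub(6) unfolding \<alpha> case_iv_def prod.case u[symmetric] by auto
  show "u \<in> A" by fact
qed

section \<open>Correspondence between sources and targets\<close>

lemma source_at_edge:
  assumes "\<kappa> < \<mu>" "source_at \<mu> \<kappa> j u \<alpha>"
  shows "\<alpha> \<in> X \<mu> \<kappa>" "plus_defined \<mu> \<kappa> (add_coord j) \<alpha> u" "target_at \<mu> \<kappa> j u (add_coord j \<alpha> u)"
proof -
  obtain A B where \<alpha>: "\<alpha> = (A, B)"
    by (cases \<alpha>)
  show mem: "\<alpha> \<in> X \<mu> \<kappa>"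
    using assms by (simp add: source_at_def \<alpha>)
  have "plus_defined \<mu> \<kappa> (add_coord j) \<alpha> u \<and> target_at \<mu> \<kappa> j u (add_coord j \<alpha> u)"
  proof (cases j)
    case True
    then have i: "case_i \<mu> \<kappa> (A, B)" "u = Max ({Max B + 1..\<mu>} - A)"
      using assms by (auto simp: source_at_def \<alpha>)
    note 1 = case_i_E1[OF assms(1) mem[unfolded \<alpha>] i]
    have "minus2 (A, insert u B) u = (A, B)"
      using 1(1) by (simp add: minus2_def)
    then show ?thesis
      using 1 True by (simp add: plus_defined_def target_at_def \<alpha> plus2_def)
  next
    case False
    have "minus1 (insert u A, B) u = (A, B)" if "u \<notin> A \<union> B"
      using that by (simp add: minus1_def)
    moreover consider "case_ii \<mu> \<kappa> (A, B)" "u = Min B - 1"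
      | "case_iii \<mu> \<kappa> (A, B)" "u = \<mu>"
      | "case_iv \<mu> \<kappa> (A, B)" "u = Max ({1..Max B - 1} - B)"
      using assms False by (auto simp: source_at_def \<alpha>)
    then have "u \<notin> A \<union> B \<and> plus1 (A, B) u \<in> X \<mu> \<kappa> \<and>
        (((A, B), plus1 (A, B) u) \<in> E2 \<mu> \<kappa> \<and> u = Min B - 1 \<or>
         ((A, B), plus1 (A, B) u) \<in> E3 \<mu> \<kappa> \<and> u = \<mu> \<or>
         ((A, B), plus1 (A, B) u) \<in> E4 \<mu> \<kappa> \<and> u = Max ({1..Max B - 1} - B))"
    proof cases
      case 1
      then show ?thesis
        using case_ii_E2[OF assms(1) mem[unfolded \<alpha>] 1] by blast
    next
      case 2
      then show ?thesis
        using case_iii_E3[OF assms(1) mem[unfolded \<alpha>] 2(1)] by blast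
    next
      case 3
      then show ?thesis
        using case_iv_E4[OF assms(1) mem[unfolded \<alpha>] 3] by blast
    qed
    ultimately show ?thesis
      using False by (simp add: plus_defined_def target_at_def \<alpha> plus1_def)
  qed
  then show "plus_defined \<mu> \<kappa> (add_coord j) \<alpha> u" "target_at \<mu> \<kappa> j u (add_coord j \<alpha> u)"
    by auto
qed

text \<open>Together with \<open>source_at_edge\<close> this identifies the targets at stage
  \<open>(j, u)\<close> with the image of the sources at that stage.\<close>

lemma target_at_edge:
  assumes "\<kappa> < \<mu>" "target_at \<mu> \<kappa> j u \<beta>"
  shows "\<exists>\<alpha>. source_at \<mu> \<kappa> j u \<alpha> \<and> \<beta> = add_coord j \<alpha> u"
proof -
  obtain A B where \<beta>: "\<beta> = (A, B)"
    by (cases \<beta>)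
  show ?thesis
  proof (cases j)
    case True
    then have 1: "(minus2 (A, B) u, (A, B)) \<in> E1 \<mu> \<kappa>" "u = Max B"
      using assms by (auto simp: target_at_def \<beta>)
    note e = E1_case_i[OF assms(1) 1(1)]
    have "source_at \<mu> \<kappa> j u (A, B - {u})"
      using e 1(2) True by (simp add: source_at_def)
    moreover have "\<beta> = add_coord j (A, B - {u}) u"
      using e(5) 1(2) True by (auto simp: \<beta> plus2_def)
    ultimately show ?thesis
      by blast
  next
    case False
    have "\<beta> = add_coord j (A - {u}, B) u" if "u \<in> A"
      using that False by (auto simp: \<beta> plus1_def)
    moreover consider "(minus1 (A, B) u, (A, B)) \<in> E2 \<mu> \<kappa>" "u = Min B - 1"
      | "(minus1 (A, B) u, (A, B)) \<in> E3 \<mu> \<kappa>" "u = \<mu>"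
      | "(minus1 (A, B) u, (A, B)) \<in> E4 \<mu> \<kappa>" "u = Max ({1..Max B - 1} - B)"
      using assms False by (auto simp: target_at_def \<beta>)
    then have "u \<in> A \<and> source_at \<mu> \<kappa> j u (A - {u}, B)"
    proof cases
      case 1
      then show ?thesis
        using E2_case_ii[OF assms(1) 1(1)] False by (simp add: source_at_def)
    next
      case 2
      then show ?thesis
        using E3_case_iii[OF assms(1) 2(1)] False by (simp add: source_at_def)
    next
      case 3
      then show ?thesis
        using E4_case_iv[OF assms(1) 3] False by (simp add: source_at_def)
    qed
    ultimately show ?thesis
      by blast
  qed
qed

section \<open>Disjointness of the predicted edges\<close>

text \<open>Each case fixes its stage, and the cases exclude one another: \<open>card B\<close>
  separates (i) and (ii) from (iii) and (iv), as \<open>\<mu> - \<kappa> \<ge> 2\<close>; covering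
  the interval above \<open>Max B\<close> up to \<open>\<mu>\<close> separates (i) from (ii), and up
  to \<open>\<mu> - 1\<close> separates (iii) from (iv).\<close>

lemma source_at_unique:
  assumes "\<kappa> + 2 \<le> \<mu>" "source_at \<mu> \<kappa> j u \<alpha>" "source_at \<mu> \<kappa> j' u' \<alpha>"
  shows "j' = j \<and> u' = u"
proof -
  obtain A B where \<alpha>: "\<alpha> = (A, B)"
    by (cases \<alpha>)
  have ii: "{Max B + 1..\<mu>} \<subseteq> A" if "case_ii \<mu> \<kappa> (A, B)"
    using that by (auto simp: case_ii_def card_1_singleton_iff)
  have excl: "\<not> (case_i \<mu> \<kappa> (A, B) \<and> case_ii \<mu> \<kappa> (A, B))"
    "\<not> (case_i \<mu> \<kappa> (A, B) \<and> case_iii \<mu> \<kappa> (A, B))"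
    "\<not> (case_i \<mu> \<kappa> (A, B) \<and> case_iv \<mu> \<kappa> (A, B))"
    "\<not> (case_ii \<mu> \<kappa> (A, B) \<and> case_iii \<mu> \<kappa> (A, B))"
    "\<not> (case_ii \<mu> \<kappa> (A, B) \<and> case_iv \<mu> \<kappa> (A, B))"
    "\<not> (case_iii \<mu> \<kappa> (A, B) \<and> case_iv \<mu> \<kappa> (A, B))"
    using ii assms(1) unfolding case_i_def case_ii_def case_iii_def case_iv_def prod.case by auto
  show ?thesis
    using assms excl unfolding source_at_def \<alpha> prod.case
    by (cases j; cases j') auto
qed

text \<open>Covering the interval above \<open>Max B\<close> separates (E1) from (E3) and (E4),
  \<open>card B\<close> separates (E2) from the rest, and \<open>Max A\<close> separates (E3) from
  (E4).\<close>

lemma target_at_unique: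
  assumes "\<kappa> + 2 \<le> \<mu>" "target_at \<mu> \<kappa> j u \<beta>" "target_at \<mu> \<kappa> j' u' \<beta>"
  shows "j' = j \<and> u' = u"
proof -
  obtain A B where \<beta>: "\<beta> = (A, B)"
    by (cases \<beta>)
  show ?thesis
    using assms unfolding target_at_def \<beta> prod.case E1_iff E2_iff E3_iff E4_iff
    by (cases j; cases j') auto
qed

text \<open>In (E2), (E3) and (E4) the vertex that the corresponding case would add is already in
  \<open>A\<close>; in (E1) there is no vertex left to add above \<open>Max B\<close>. The other
  cases fail by the size of \<open>B\<close>, by \<open>Max A\<close> or by the covered
  interval.\<close>

lemma target_at_not_source_at:
  assumes "\<kappa> + 2 \<le> \<mu>" "target_at \<mu> \<kappa> j u \<beta>"
  shows "\<not> source_at \<mu> \<kappa> j' u' \<beta>"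
proof -
  obtain A B where \<beta>: "\<beta> = (A, B)"
    by (cases \<beta>)
  consider "(minus2 (A, B) u, (A, B)) \<in> E1 \<mu> \<kappa>"
    | "(minus1 (A, B) u, (A, B)) \<in> E2 \<mu> \<kappa>"
    | "(minus1 (A, B) u, (A, B)) \<in> E3 \<mu> \<kappa>"
    | "(minus1 (A, B) u, (A, B)) \<in> E4 \<mu> \<kappa>"
    using assms by (auto simp: target_at_def \<beta> split: if_splits)
  then have "\<not> case_i \<mu> \<kappa> (A, B) \<and> \<not> case_ii \<mu> \<kappa> (A, B) \<and>
      \<not> case_iii \<mu> \<kappa> (A, B) \<and> \<not> case_iv \<mu> \<kappa> (A, B)"
  proof cases
    case 1
    then have *: "(A, B) \<in> X \<mu> \<kappa>" "card B > 1" "{Max B + 1..\<mu>} \<subseteq> A"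
      by (auto simp: E1_iff)
    have sub: "{Max B + 1..\<mu> - 1} \<subseteq> A"
      by (rule order.trans[OF _ *(3)]) auto
    \<comment> \<open>Case (iv) needs \<open>\<mu>\<close> outside both coordinates, but then
      \<open>\<mu>\<close> lies in the covered interval, hence in \<open>A\<close>.\<close>
    have "\<not> max (Max A) (Max B) < \<mu>"
    proof
      assume less: "max (Max A) (Max B) < \<mu>"
      then have "\<mu> \<in> A"
        using *(3) by auto
      then have "\<mu> \<le> Max A"
        using finite_X_coords[OF *(1)] by simp
      then show False
        using less by simp
    qed
    then show ?thesis
      using *(2,3) sub unfolding case_i_def case_ii_def case_iii_def case_iv_def prod.case by auto
  next
    case 2
    then have *: "card B = 1" "{Min B + 1..\<mu>} \<subseteq> A" "Min B - 1 \<in> A"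
      by (auto simp: E2_iff)
    then have "{Max B + 1..\<mu>} \<subseteq> A"
      by (auto simp: card_1_singleton_iff)
    then show ?thesis
      using * assms(1) unfolding case_i_def case_ii_def case_iii_def case_iv_def prod.case by auto
  next
    case 3
    then show ?thesis
      using assms(1) unfolding E3_iff case_i_def case_ii_def case_iii_def case_iv_def prod.case by auto
  next
    case 4
    then show ?thesis
      using assms(1) unfolding E4_iff case_i_def case_ii_def case_iii_def case_iv_def prod.case by auto
  qed
  then show ?thesis
    by (auto simp: source_at_def \<beta> split: if_splits)
qed

section \<open>Competition for a pair of cells\<close>

text \<open>Each branch compares \<open>u\<close> with the vertex that the prediction prefers. If
  that vertex is still free, the smaller cell is a source at its stage; if it is already used, the
  larger cell is a target at its stage. In the same coordinate this vertex is never smaller than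
  \<open>u\<close>, and equality yields the predicted edge itself; a stage of coordinate 2 always
  precedes one of coordinate 1.\<close>

lemma competing_edge:
  assumes "\<kappa> + 2 \<le> \<mu>" "\<alpha> \<in> X \<mu> \<kappa>"
    and def: "plus_defined \<mu> \<kappa> (add_coord j) \<alpha> u"
    and not_src: "\<And>j' u'. \<not> source_at \<mu> \<kappa> j' u' (add_coord j \<alpha> u)"
  shows "source_at \<mu> \<kappa> j u \<alpha> \<or>
    (\<exists>(j', u') \<in> before j u. source_at \<mu> \<kappa> j' u' \<alpha> \<or> target_at \<mu> \<kappa> j' u' (add_coord j \<alpha> u))"
proof -
  obtain A B where \<alpha>: "\<alpha> = (A, B)"
    by (cases \<alpha>)
  have mem: "(A, B) \<in> X \<mu> \<kappa>"
    using assms \<alpha> by simp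
  then have sub: "A \<subseteq> {1..\<mu>}" "B \<subseteq> {1..\<mu>}" "A \<noteq> {}" "B \<noteq> {}" "A \<inter> B = {}"
      "card A \<le> \<mu> - \<kappa>" "card B \<le> \<mu> - \<kappa>"
    using assms(1) by (auto simp: X_iff)
  have fin: "finite A" "finite B"
    using finite_X_coords mem by auto
  have u: "u \<notin> A" "u \<notin> B"
    using def by (auto simp: plus_defined_def \<alpha>)
  have card: "card A > 0" "card B > 0"
    using fin sub by (auto simp: card_gt_0_iff)
  have tgtI: "\<exists>(j', u') \<in> before j u. source_at \<mu> \<kappa> j' u' \<alpha> \<or> target_at \<mu> \<kappa> j' u' (add_coord j \<alpha> u)"
    if "target_at \<mu> \<kappa> j' u' (add_coord j \<alpha> u)" "(j', u') \<in> before j u" for j' u'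
    using that by blast
  have srcI: "\<exists>(j', u') \<in> before j u. source_at \<mu> \<kappa> j' u' \<alpha> \<or> target_at \<mu> \<kappa> j' u' (add_coord j \<alpha> u)"
    if "source_at \<mu> \<kappa> j' u' \<alpha>" "(j', u') \<in> before j u" for j' u'
    using that by blast
  have Max_less: "u < Max B" if "u \<le> Max B"
    using that u fin sub Max_in le_neq_implies_less by metis
  have E1_tgt: "target_at \<mu> \<kappa> True (Max B') (A', B')"
    if "(A', B') \<in> X \<mu> \<kappa>" "card B' > 1" "{Max B' + 1..\<mu>} \<subseteq> A'" for A' B'
    using that by (simp add: target_at_def E1_iff)
  show ?thesis
  proof (cases j)
    case True
    have mem': "(A, insert u B) \<in> X \<mu> \<kappa>"
      using def True by (simp add: plus_defined_def \<alpha> plus2_def)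
    then have u_le: "u \<le> \<mu>" and "card (insert u B) \<le> \<mu> - \<kappa>"
      using assms(1) by (auto simp: X_iff)
    then have card_less: "card B < \<mu> - \<kappa>"
      using fin u by simp
    show ?thesis
    proof (cases "{Max B + 1..\<mu>} \<subseteq> A")
      case False
      let ?v = "Max ({Max B + 1..\<mu>} - A)"
      have src: "source_at \<mu> \<kappa> True ?v \<alpha>"
        using False card_less mem by (simp add: source_at_def case_i_def \<alpha>)
      have v: "?v \<in> {Max B + 1..\<mu>} - A"
        using False by (intro Max_in) auto
      \<comment> \<open>Either \<open>u\<close> is at most \<open>Max B\<close>, below
        \<open>?v\<close>, or it is one of the missing vertices over which \<open>?v\<close> is
        maximal.\<close>
      have "u \<le> ?v"
      proof (cases "u \<le> Max B")
        case True
        then show ?thesis using v by simp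
      next
        case False
        then show ?thesis using u u_le by (intro Max_ge) auto
      qed
      then show ?thesis
        using src srcI[OF src] True by (cases "u = ?v") (auto simp: before_def)
    next
      case full: True
      \<comment> \<open>No vertex outside \<open>A\<close> is left above \<open>Max B\<close>, so
        \<open>u\<close> lies below and adding it keeps the maximum; the larger cell then satisfies
        (E1) at \<open>Max B\<close>.\<close>
      have "u < Max B"
      proof -
        have "\<not> Max B + 1 \<le> u"
          using full u u_le by auto
        then show ?thesis
          using Max_less by linarith
      qed
      then have "Max (insert u B) = Max B"
        using fin sub by simp
      then have "target_at \<mu> \<kappa> True (Max B) (A, insert u B)"
        using E1_tgt[OF mem'] full card fin u by simp
      then show ?thesis
        using tgtI[of True "Max B"] \<open>u < Max B\<close> True by (simp add: before_def \<alpha> plus2_def)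
    qed
  next
    case False
    have mem': "(insert u A, B) \<in> X \<mu> \<kappa>"
      using def False by (simp add: plus_defined_def \<alpha> plus1_def)
    then have u_range: "1 \<le> u" "u \<le> \<mu>" and "card (insert u A) \<le> \<mu> - \<kappa>"
      using assms(1) by (auto simp: X_iff)
    then have card_less: "card A < \<mu> - \<kappa>"
      using fin u by simp
    have card_ins: "card (insert u A) > 1"
      using fin u card by simp
    have add: "add_coord j \<alpha> u = (insert u A, B)"
      using False by (simp add: \<alpha> plus1_def)
    have earlier_target: "\<exists>(j', u') \<in> before j u. source_at \<mu> \<kappa> j' u' \<alpha> \<or>
        target_at \<mu> \<kappa> j' u' (add_coord j \<alpha> u)"
      if "target_at \<mu> \<kappa> False v (insert u A, B)" "u < v" for v
    proof (rule tgtI)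
      show "target_at \<mu> \<kappa> False v (add_coord j \<alpha> u)"
        unfolding add by fact
      show "(False, v) \<in> before j u"
        using that False by (simp add: before_def)
    qed
    \<comment> \<open>Here the assumption that the larger cell is not a source enters: either its
      second coordinate has full size, or the interval above \<open>Max B\<close> is covered once
      \<open>u\<close> is added.\<close>
    have "\<not> case_i \<mu> \<kappa> (insert u A, B)"
      using not_src[of True] mem' unfolding add by (auto simp: source_at_def)
    then consider (many) "{Max B + 1..\<mu>} \<subseteq> insert u A" "card B > 1"
      | (one) "{Max B + 1..\<mu>} \<subseteq> insert u A" "card B = 1"
      | (top) "card B = \<mu> - \<kappa>" "\<not> {Max B + 1..\<mu>} \<subseteq> insert u A"
      using sub card unfolding case_i_def prod.case by linarith
    then show ?thesis
    proof cases
      case many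
      then show ?thesis
      proof -
        have "target_at \<mu> \<kappa> True (Max B) (add_coord j \<alpha> u)"
          unfolding add using E1_tgt[OF mem'] many by blast
        moreover have "(True, Max B) \<in> before j u"
          using False by (simp add: before_def)
        ultimately show ?thesis
          by blast
      qed
    next
      case one
      then obtain b where B: "B = {b}"
        by (auto simp: card_1_singleton_iff)
      show ?thesis
      proof (cases "{b + 1..\<mu>} \<subseteq> A")
        case nfull: False
        have "case_i \<mu> \<kappa> (A, B)"
          using nfull assms(1) unfolding case_i_def prod.case B by simp
        then have "source_at \<mu> \<kappa> True (Max ({Max B + 1..\<mu>} - A)) \<alpha>"
          using mem by (simp add: source_at_def \<alpha>)
        then show ?thesis
          using False by (intro disjI2 srcI) (auto simp: before_def)
      next
        case full: True
        have "u < b"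
        proof -
          have "\<not> b + 1 \<le> u"
            using full u u_range by auto
          then show ?thesis
            using u B by auto
        qed
        \<comment> \<open>The preferred vertex is now \<open>b - 1\<close>, named in (ii) and (E2);
          \<open>u < b\<close> gives \<open>u \<le> b - 1\<close>.\<close>
        show ?thesis
        proof (cases "b - 1 \<in> A")
          case out: False
          then have "source_at \<mu> \<kappa> False (b - 1) \<alpha>"
            using full card_less mem u_range \<open>u < b\<close> by (auto simp: source_at_def case_ii_def \<alpha> B)
          then show ?thesis
            using srcI[of False "b - 1"] False \<open>u < b\<close> by (cases "u = b - 1") (auto simp: before_def)
        next
          case inA: True
          then have "u < b - 1"
            using \<open>u < b\<close> u by (cases "u = b - 1") auto
          moreover have "target_at \<mu> \<kappa> False (b - 1) (insert u A, B)"
            using inA full card_ins mem' by (auto simp: target_at_def E2_iff B)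
          ultimately show ?thesis
            using earlier_target[of "b - 1"] by blast
        qed
      qed
    next
      case top
      show ?thesis
      proof (cases "Max A = \<mu>")
        case True
        then have "\<mu> \<in> A"
          using fin sub Max_in by metis
        then have "u < \<mu>"
          using u u_range by (cases "u = \<mu>") auto
        moreover have "Max (insert u A) = \<mu>"
          using True u_range fin sub by simp
        then have "target_at \<mu> \<kappa> False \<mu> (insert u A, B)"
          using top card_ins mem' by (simp add: target_at_def E3_iff)
        ultimately show ?thesis
          using earlier_target[of \<mu>] by blast
      next
        case max_ne: False
        have "Max A \<in> A"
          using fin sub by simp
        then have max_less: "Max A < \<mu>"
          using sub(1) max_ne by auto
        then have "\<mu> \<notin> A"
          using fin Max_ge leD by blast
        show ?thesis
        proof (cases "{Max B + 1..\<mu> - 1} \<subseteq> A")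
          case nfull: False
          then have "source_at \<mu> \<kappa> False \<mu> \<alpha>"
            using top max_less card_less mem by (simp add: source_at_def case_iii_def \<alpha>)
          then show ?thesis
            using srcI[of False \<mu>] False u_range by (cases "u = \<mu>") (auto simp: before_def)
        next
          case full: True
          obtain x where x: "x \<in> {Max B + 1..\<mu>}" "x \<notin> insert u A"
            using top(2) by blast
          \<comment> \<open>\<open>A\<close> covers everything strictly between \<open>Max B\<close>
            and \<open>\<mu>\<close>, so the only gap is \<open>\<mu>\<close> itself; since the
            larger cell has this gap too, \<open>u\<close> is not \<open>\<mu>\<close>.\<close>
          have "x = \<mu>"
          proof (rule ccontr)
            assume "x \<noteq> \<mu>"
            then have "x \<in> {Max B + 1..\<mu> - 1}"
              using x by auto
            then show False
              using full x by blast
          qed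
          then have "u < \<mu>" and Max_B: "Max B < \<mu>"
            using x u_range by auto
          have "u < Max B"
          proof (rule ccontr)
            assume "\<not> u < Max B"
            then have "u \<in> {Max B + 1..\<mu> - 1}"
              using Max_less \<open>u < \<mu>\<close> by force
            then show False
              using full u by blast
          qed
          then have u_in: "u \<in> {1..Max B - 1} - B"
            using u u_range by auto
          \<comment> \<open>The vertex added in (iv) and removed in (E4). As \<open>u\<close>
            competes in this maximum, \<open>u \<le> v\<close>; membership of \<open>v\<close> in
            \<open>A\<close> decides between a source and a target.\<close>
          define v where "v = Max ({1..Max B - 1} - B)"
          have "u \<le> v"
            unfolding v_def using u_in by (intro Max_ge) auto
          have v_in: "v \<in> {1..Max B - 1} - B"
            unfolding v_def using u_in by (intro Max_in) auto
          have nsub: "\<not> {1..Max B - 1} \<subseteq> B"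
            using u_in by blast
          show ?thesis
          proof (cases "v \<in> A")
            case out: False
            then have "case_iv \<mu> \<kappa> (A, B)"
              unfolding case_iv_def prod.case v_def[symmetric]
              using card_less top max_less Max_B full nsub by simp
            then have "source_at \<mu> \<kappa> False v \<alpha>"
              unfolding source_at_def \<alpha> prod.case v_def[symmetric] using mem by simp
            then show ?thesis
              using srcI[of False v] False \<open>u \<le> v\<close> by (cases "u = v") (auto simp: before_def)
          next
            case inA: True
            then have "u < v"
              using \<open>u \<le> v\<close> u by (cases "u = v") auto
            have "Max (insert u A) < \<mu>"
              using \<open>u < \<mu>\<close> max_less fin sub by simp
            then have "(minus1 (insert u A, B) v, (insert u A, B)) \<in> E4 \<mu> \<kappa>"
              unfolding E4_iff v_def[symmetric]
              using mem' card_ins top full nsub inA by auto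
            then have "target_at \<mu> \<kappa> False v (insert u A, B)"
              unfolding target_at_def prod.case v_def[symmetric] by simp
            then show ?thesis
              using earlier_target[of v] \<open>u < v\<close> by blast
          qed
        qed
      qed
    qed
  qed
qed

subsection \<open>The state after each stage\<close>

text \<open>The invariant while dimension \<open>p\<close> is processed, with \<open>T\<close> the
  stages done. Sources of dimension \<open>p + 1\<close> are gone because that dimension was the
  lower one in the preceding step; targets of dimension \<open>p\<close> are removed only in the
  following step. Dimensions above \<open>p + 1\<close> are never read again and stay
  unconstrained.\<close>

definition stage_state :: "nat \<Rightarrow> nat \<Rightarrow> nat \<Rightarrow> (bool \<times> nat) set \<Rightarrow> state \<Rightarrow> bool" where
  "stage_state \<mu> \<kappa> p T = (\<lambda>(F, \<A>).
     F = {(\<alpha>, add_coord j \<alpha> u) | \<alpha> j u. source_at \<mu> \<kappa> j u \<alpha> \<and>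
            (p < cell_dim \<alpha> \<or> cell_dim \<alpha> = p \<and> (j, u) \<in> T)} \<and>
     \<A> p = {\<alpha> \<in> X \<mu> \<kappa>. cell_dim \<alpha> = p \<and> (\<forall>(j, u) \<in> T. \<not> source_at \<mu> \<kappa> j u \<alpha>)} \<and>
     \<A> (p + 1) = {\<beta> \<in> X \<mu> \<kappa>. cell_dim \<beta> = p + 1 \<and> (\<forall>j u. \<not> source_at \<mu> \<kappa> j u \<beta>) \<and>
                        (\<forall>(j, u) \<in> T. \<not> target_at \<mu> \<kappa> j u \<beta>)} \<and>
     (\<forall>q < p. \<A> q = {\<alpha> \<in> X \<mu> \<kappa>. cell_dim \<alpha> = q}))"

lemma source_at_range:
  assumes "\<kappa> < \<mu>" "source_at \<mu> \<kappa> j u \<alpha>"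
  shows "u \<in> {1..\<mu>}"
  using source_at_edge(2)[OF assms] assms(1)
  by (cases j; cases \<alpha>) (auto simp: plus_defined_def plus1_def plus2_def X_iff)

lemma target_at_range:
  assumes "\<kappa> < \<mu>" "target_at \<mu> \<kappa> j u \<beta>"
  shows "u \<in> {1..\<mu>}"
  using target_at_edge[OF assms] source_at_range[OF assms(1)] by blast

text \<open>Stages with vertices outside \<open>{1..\<mu>}\<close> carry no predicted edges. This
  lets the end of one loop be identified with the start of the next.\<close>

lemma stage_state_cong:
  assumes "\<kappa> < \<mu>" "\<And>j u. u \<in> {1..\<mu>} \<Longrightarrow> (j, u) \<in> T \<longleftrightarrow> (j, u) \<in> T'"
  shows "stage_state \<mu> \<kappa> p T = stage_state \<mu> \<kappa> p T'"
proof -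
  have src_T: "source_at \<mu> \<kappa> j u \<alpha> \<Longrightarrow> (j, u) \<in> T \<longleftrightarrow> (j, u) \<in> T'" for j u \<alpha>
    using assms source_at_range by blast
  have tgt_T: "target_at \<mu> \<kappa> j u \<beta> \<Longrightarrow> (j, u) \<in> T \<longleftrightarrow> (j, u) \<in> T'" for j u \<beta>
    using assms target_at_range by blast
  have 1: "{(\<alpha>, add_coord j \<alpha> u) | \<alpha> j u. source_at \<mu> \<kappa> j u \<alpha> \<and>
            (p < cell_dim \<alpha> \<or> cell_dim \<alpha> = p \<and> (j, u) \<in> T)} =
        {(\<alpha>, add_coord j \<alpha> u) | \<alpha> j u. source_at \<mu> \<kappa> j u \<alpha> \<and>
            (p < cell_dim \<alpha> \<or> cell_dim \<alpha> = p \<and> (j, u) \<in> T')}"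
    using src_T by blast
  have 2: "(\<forall>(j, u) \<in> T. \<not> source_at \<mu> \<kappa> j u \<alpha>) = (\<forall>(j, u) \<in> T'. \<not> source_at \<mu> \<kappa> j u \<alpha>)" for \<alpha>
    using src_T by blast
  have 3: "(\<forall>(j, u) \<in> T. \<not> target_at \<mu> \<kappa> j u \<beta>) = (\<forall>(j, u) \<in> T'. \<not> target_at \<mu> \<kappa> j u \<beta>)" for \<beta>
    using tgt_T by blast
  show ?thesis
    unfolding stage_state_def 1 2 3 ..
qed

lemma vertex_step_state:
  assumes "\<kappa> + 2 \<le> \<mu>" and st: "stage_state \<mu> \<kappa> p (before j u) st"
  shows "stage_state \<mu> \<kappa> p (insert (j, u) (before j u)) (vertex_step \<mu> \<kappa> p (add_coord j) u st)"
proof -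
  have \<kappa>: "\<kappa> < \<mu>"
    using assms by simp
  obtain F \<A> where st_eq: "st = (F, \<A>)"
    by (cases st)
  define T where "T = before j u"
  have not_T: "(j, u) \<notin> T"
    by (simp add: T_def before_def)
  have F: "F = {(\<alpha>, add_coord j \<alpha> u) | \<alpha> j u. source_at \<mu> \<kappa> j u \<alpha> \<and>
        (p < cell_dim \<alpha> \<or> cell_dim \<alpha> = p \<and> (j, u) \<in> T)}"
    and Ap: "\<A> p = {\<alpha> \<in> X \<mu> \<kappa>. cell_dim \<alpha> = p \<and> (\<forall>(j, u) \<in> T. \<not> source_at \<mu> \<kappa> j u \<alpha>)}"
    and Ap1: "\<A> (p + 1) = {\<beta> \<in> X \<mu> \<kappa>. cell_dim \<beta> = p + 1 \<and> (\<forall>j u. \<not> source_at \<mu> \<kappa> j u \<beta>) \<and>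
        (\<forall>(j, u) \<in> T. \<not> target_at \<mu> \<kappa> j u \<beta>)}"
    and Aq: "\<forall>q < p. \<A> q = {\<alpha> \<in> X \<mu> \<kappa>. cell_dim \<alpha> = q}"
    using st unfolding stage_state_def st_eq prod.case T_def[symmetric] by blast+
  have add_dim: "add_coord j' \<alpha> u' \<in> X \<mu> \<kappa>" "cell_dim (add_coord j' \<alpha> u') = cell_dim \<alpha> + 1"
    if "source_at \<mu> \<kappa> j' u' \<alpha>" for j' u' \<alpha>
    using source_at_edge[OF \<kappa> that] cell_dim_add_coord[OF \<kappa>] by (auto simp: plus_defined_def)
  define M where "M = {\<alpha>. source_at \<mu> \<kappa> j u \<alpha> \<and> cell_dim \<alpha> = p}"
  \<comment> \<open>The greedy choice coincides with the prediction: \<open>competing_edge\<close>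
    excludes any further pair, as an earlier stage has already taken one of its cells, and
    uniqueness of stages keeps the predicted pairs available.\<close>
  have M: "matched \<mu> \<kappa> p j u \<A> = M"
  proof (intro equalityI subsetI)
    fix \<alpha>
    assume "\<alpha> \<in> matched \<mu> \<kappa> p j u \<A>"
    then have *: "\<alpha> \<in> \<A> p" "plus_defined \<mu> \<kappa> (add_coord j) \<alpha> u" "add_coord j \<alpha> u \<in> \<A> (p + 1)"
      by (auto simp: matched_def)
    have "\<alpha> \<in> X \<mu> \<kappa>"
      using *(1) unfolding Ap by blast
    moreover have "\<not> source_at \<mu> \<kappa> j' u' (add_coord j \<alpha> u)" for j' u'
      using *(3) unfolding Ap1 by blast
    ultimately have "source_at \<mu> \<kappa> j u \<alpha> \<or>
        (\<exists>(j', u') \<in> T. source_at \<mu> \<kappa> j' u' \<alpha> \<or> target_at \<mu> \<kappa> j' u' (add_coord j \<alpha> u))"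
      unfolding T_def using *(2) by (intro competing_edge assms(1))
    then show "\<alpha> \<in> M"
      using * unfolding M_def Ap Ap1 by blast
  next
    fix \<alpha>
    assume "\<alpha> \<in> M"
    then have src: "source_at \<mu> \<kappa> j u \<alpha>" and dim: "cell_dim \<alpha> = p"
      by (auto simp: M_def)
    note e = source_at_edge[OF \<kappa> src]
    have "\<not> source_at \<mu> \<kappa> j' u' \<alpha>" if "(j', u') \<in> T" for j' u'
      using source_at_unique[OF assms(1) src] that not_T by blast
    moreover have "\<not> target_at \<mu> \<kappa> j' u' (add_coord j \<alpha> u)" if "(j', u') \<in> T" for j' u'
      using target_at_unique[OF assms(1) e(3)] that not_T by blast
    ultimately show "\<alpha> \<in> matched \<mu> \<kappa> p j u \<A>"
      using e dim add_dim[OF src] target_at_not_source_at[OF assms(1) e(3)]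
      unfolding matched_def Ap Ap1 by blast
  qed
  have img: "(\<lambda>\<alpha>. add_coord j \<alpha> u) ` M = {\<beta> \<in> X \<mu> \<kappa>. cell_dim \<beta> = p + 1 \<and> target_at \<mu> \<kappa> j u \<beta>}"
  proof (intro equalityI subsetI)
    fix \<beta>
    assume "\<beta> \<in> (\<lambda>\<alpha>. add_coord j \<alpha> u) ` M"
    then show "\<beta> \<in> {\<beta> \<in> X \<mu> \<kappa>. cell_dim \<beta> = p + 1 \<and> target_at \<mu> \<kappa> j u \<beta>}"
      using source_at_edge[OF \<kappa>] add_dim by (auto simp: M_def)
  next
    fix \<beta>
    assume *: "\<beta> \<in> {\<beta> \<in> X \<mu> \<kappa>. cell_dim \<beta> = p + 1 \<and> target_at \<mu> \<kappa> j u \<beta>}"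
    then obtain \<alpha> where "source_at \<mu> \<kappa> j u \<alpha>" "\<beta> = add_coord j \<alpha> u"
      using target_at_edge[OF \<kappa>] by blast
    then show "\<beta> \<in> (\<lambda>\<alpha>. add_coord j \<alpha> u) ` M"
      using * add_dim(2) by (auto simp: M_def)
  qed
  have step: "vertex_step \<mu> \<kappa> p (add_coord j) u st =
      (F \<union> (\<lambda>\<alpha>. (\<alpha>, add_coord j \<alpha> u)) ` M,
        \<A>(p := \<A> p - M, p + 1 := \<A> (p + 1) - (\<lambda>\<alpha>. add_coord j \<alpha> u) ` M))"
    unfolding st_eq by (subst vertex_step_eq) (auto simp: Ap M)
  have "F \<union> (\<lambda>\<alpha>. (\<alpha>, add_coord j \<alpha> u)) ` M =
      {(\<alpha>, add_coord j' \<alpha> u') | \<alpha> j' u'. source_at \<mu> \<kappa> j' u' \<alpha> \<and>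
        (p < cell_dim \<alpha> \<or> cell_dim \<alpha> = p \<and> (j', u') \<in> insert (j, u) T)}"
    unfolding F M_def by blast
  moreover have "\<A> p - M =
      {\<alpha> \<in> X \<mu> \<kappa>. cell_dim \<alpha> = p \<and> (\<forall>(j, u) \<in> insert (j, u) T. \<not> source_at \<mu> \<kappa> j u \<alpha>)}"
    unfolding Ap M_def by blast
  moreover have "\<A> (p + 1) - (\<lambda>\<alpha>. add_coord j \<alpha> u) ` M =
      {\<beta> \<in> X \<mu> \<kappa>. cell_dim \<beta> = p + 1 \<and> (\<forall>j u. \<not> source_at \<mu> \<kappa> j u \<beta>) \<and>
        (\<forall>(j, u) \<in> insert (j, u) T. \<not> target_at \<mu> \<kappa> j u \<beta>)}"
    unfolding Ap1 img by blast
  ultimately show ?thesis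
    unfolding step stage_state_def prod.case T_def[symmetric] using Aq by simp
qed

lemma coordinate_step_state:
  assumes "\<kappa> + 2 \<le> \<mu>" "stage_state \<mu> \<kappa> p (before j \<mu>) st"
  shows "stage_state \<mu> \<kappa> p (before j 0) (coordinate_step \<mu> \<kappa> p (add_coord j) st)"
proof -
  \<comment> \<open>Generalised to loops starting at any \<open>n\<close>, since finishing stage
    \<open>Suc n\<close> leaves exactly the stages \<open>before j n\<close> done.\<close>
  have "stage_state \<mu> \<kappa> p (before j 0) (fold (vertex_step \<mu> \<kappa> p (add_coord j)) (rev [1..<n + 1]) st)"
    if "stage_state \<mu> \<kappa> p (before j n) st" for n
    using that
  proof (induction n arbitrary: st)
    case 0
    then show ?case by simp
  next
    case (Suc n)
    have "insert (j, Suc n) (before j (Suc n)) = before j n"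
      by (auto simp: before_def)
    then have "stage_state \<mu> \<kappa> p (before j n) (vertex_step \<mu> \<kappa> p (add_coord j) (Suc n) st)"
      using vertex_step_state[OF assms(1) Suc.prems] by simp
    from Suc.IH[OF this] show ?case by simp
  qed
  then show ?thesis
    using assms(2) by (simp add: coordinate_step_def)
qed

lemma dimension_step_state:
  assumes "\<kappa> + 2 \<le> \<mu>" and st: "stage_state \<mu> \<kappa> (Suc p) UNIV st"
  shows "stage_state \<mu> \<kappa> p UNIV (dimension_step \<mu> \<kappa> p st)"
proof -
  have \<kappa>: "\<kappa> < \<mu>"
    using assms by simp
  obtain F \<A> where st_eq: "st = (F, \<A>)"
    by (cases st)
  \<comment> \<open>With all stages of dimension \<open>Suc p\<close> done, its sources are gone and
    lower cells are untouched, which is the invariant for \<open>p\<close> with no stage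
    done.\<close>
  have start: "stage_state \<mu> \<kappa> p {} st"
  proof -
    have "p < d \<longleftrightarrow> Suc p < d \<or> d = Suc p" for d
      by auto
    then show ?thesis
      using st unfolding stage_state_def st_eq by simp
  qed
  show ?thesis
  proof (cases "\<A> p \<noteq> {} \<and> \<A> (p + 1) \<noteq> {}")
    case True
    have "stage_state \<mu> \<kappa> p (before True \<mu>) st"
      using start stage_state_cong[OF \<kappa>, of "before True \<mu>" "{}"] by (simp add: before_def)
    note coordinate_step_state[OF assms(1) this]
    \<comment> \<open>\<open>before True 0\<close> and \<open>before False \<mu>\<close> agree on
      \<open>{1..\<mu>}\<close>: all of coordinate 2, none of coordinate 1.\<close>
    then have "stage_state \<mu> \<kappa> p (before False \<mu>) (coordinate_step \<mu> \<kappa> p plus2 st)"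
      using stage_state_cong[OF \<kappa>, of "before True 0" "before False \<mu>"] by (simp add: before_def)
    note coordinate_step_state[OF assms(1) this]
    then show ?thesis
      using stage_state_cong[OF \<kappa>, of "before False 0" UNIV] True
      by (simp add: before_def dimension_step_def st_eq)
  next
    case False
    have Ap: "\<A> p = {\<alpha> \<in> X \<mu> \<kappa>. cell_dim \<alpha> = p}"
      and Ap1: "\<A> (p + 1) = {\<beta> \<in> X \<mu> \<kappa>. cell_dim \<beta> = p + 1 \<and> (\<forall>j u. \<not> source_at \<mu> \<kappa> j u \<beta>)}"
      using start unfolding stage_state_def st_eq by auto
    \<comment> \<open>If the loop is skipped, no predicted edge starts in dimension
      \<open>p\<close>: both its ends would still be present and the guard would hold.\<close>
    have no_src: "cell_dim \<alpha> \<noteq> p" if src: "source_at \<mu> \<kappa> j u \<alpha>" for j u \<alpha>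
    proof
      assume dim: "cell_dim \<alpha> = p"
      note e = source_at_edge[OF \<kappa> src]
      have "\<alpha> \<in> \<A> p"
        using e dim by (simp add: Ap)
      moreover have "add_coord j \<alpha> u \<in> \<A> (p + 1)"
        using e dim cell_dim_add_coord[OF \<kappa> e(1,2)] target_at_not_source_at[OF assms(1) e(3)]
        unfolding Ap1 by (simp add: plus_defined_def)
      ultimately show False
        using False by blast
    qed
    have no_tgt: "cell_dim \<beta> \<noteq> p + 1" if "target_at \<mu> \<kappa> j u \<beta>" for j u \<beta>
    proof -
      obtain \<alpha> where "source_at \<mu> \<kappa> j u \<alpha>" "\<beta> = add_coord j \<alpha> u"
        using target_at_edge[OF \<kappa> \<open>target_at \<mu> \<kappa> j u \<beta>\<close>] by blast
      then show ?thesis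
        using no_src cell_dim_add_coord[OF \<kappa>] source_at_edge(1,2)[OF \<kappa>] by auto
    qed
    have "dimension_step \<mu> \<kappa> p st = st"
      using False by (auto simp: dimension_step_def st_eq)
    moreover have "stage_state \<mu> \<kappa> p UNIV st"
      using start no_src no_tgt unfolding stage_state_def st_eq by fastforce
    ultimately show ?thesis
      by simp
  qed
qed

section \<open>The complete gradient field\<close>

lemma W_eq:
  assumes "\<kappa> + 2 \<le> \<mu>"
  shows "W \<mu> \<kappa> = {(\<alpha>, add_coord j \<alpha> u) | \<alpha> j u. source_at \<mu> \<kappa> j u \<alpha>}"
proof -
  have \<kappa>: "\<kappa> < \<mu>"
    using assms by simp
  let ?init = "({}, \<lambda>p. {\<alpha> \<in> X \<mu> \<kappa>. cell_dim \<alpha> = p}) :: state"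
  have dim_le: "cell_dim \<alpha> \<le> dim_X \<mu> \<kappa>" if "\<alpha> \<in> X \<mu> \<kappa>" for \<alpha>
    unfolding dim_X_def using that finite_X by (intro Max_ge) auto
  \<comment> \<open>A predicted source has a target one dimension higher, so none occurs in the top
    dimension. The initial state thus satisfies the invariant there with all stages counted as
    done.\<close>
  have "cell_dim \<alpha> < dim_X \<mu> \<kappa>" if "source_at \<mu> \<kappa> j u \<alpha>" for j u \<alpha>
    using source_at_edge(1,2)[OF \<kappa> that] cell_dim_add_coord[OF \<kappa>] dim_le[of "add_coord j \<alpha> u"]
    by (auto simp: plus_defined_def)
  then have init: "stage_state \<mu> \<kappa> (dim_X \<mu> \<kappa>) UNIV ?init"
    using dim_le unfolding stage_state_def by fastforce
  have "stage_state \<mu> \<kappa> 0 UNIV (fold (dimension_step \<mu> \<kappa>) (rev [0..<n]) st)"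
    if "stage_state \<mu> \<kappa> n UNIV st" for n st
    using that
  proof (induction n arbitrary: st)
    case 0
    then show ?case by simp
  next
    case (Suc n)
    from Suc.IH[OF dimension_step_state[OF assms Suc.prems]] show ?case by simp
  qed
  from this[OF init] show ?thesis
    unfolding W_def stage_state_def by (auto simp: split_def)
qed

section \<open>Redundant cells of the four families\<close>

theorem corollary4p4:
  fixes \<mu> \<kappa> :: nat
  assumes "2 \<le> \<kappa>" and "\<kappa> \<le> \<mu> - 2"
  shows
    "(redundant_cells (W \<mu> \<kappa> \<inter> E1 \<mu> \<kappa>) = {\<alpha> \<in> X \<mu> \<kappa>. case_i \<mu> \<kappa> \<alpha>} \<and>
      (\<forall>A B. (A, B) \<in> X \<mu> \<kappa> \<and> case_i \<mu> \<kappa> (A, B) \<longrightarrow>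
         ((A, B), plus2 (A, B) (Max ({Max B + 1..\<mu>} - A))) \<in> W \<mu> \<kappa> \<inter> E1 \<mu> \<kappa>)) \<and>
     (redundant_cells (W \<mu> \<kappa> \<inter> E2 \<mu> \<kappa>) = {\<alpha> \<in> X \<mu> \<kappa>. case_ii \<mu> \<kappa> \<alpha>} \<and>
      (\<forall>A B. (A, B) \<in> X \<mu> \<kappa> \<and> case_ii \<mu> \<kappa> (A, B) \<longrightarrow>
         ((A, B), plus1 (A, B) (Min B - 1)) \<in> W \<mu> \<kappa> \<inter> E2 \<mu> \<kappa>)) \<and>
     (redundant_cells (W \<mu> \<kappa> \<inter> E3 \<mu> \<kappa>) = {\<alpha> \<in> X \<mu> \<kappa>. case_iii \<mu> \<kappa> \<alpha>} \<and>
      (\<forall>A B. (A, B) \<in> X \<mu> \<kappa> \<and> case_iii \<mu> \<kappa> (A, B) \<longrightarrow>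
         ((A, B), plus1 (A, B) \<mu>) \<in> W \<mu> \<kappa> \<inter> E3 \<mu> \<kappa> \<and>
         \<not> {Max B + 1..\<mu>} \<subseteq> A)) \<and>
     (redundant_cells (W \<mu> \<kappa> \<inter> E4 \<mu> \<kappa>) = {\<alpha> \<in> X \<mu> \<kappa>. case_iv \<mu> \<kappa> \<alpha>} \<and>
      (\<forall>A B. (A, B) \<in> X \<mu> \<kappa> \<and> case_iv \<mu> \<kappa> (A, B) \<longrightarrow>
         ((A, B), plus1 (A, B) (Max ({1..Max B - 1} - B))) \<in> W \<mu> \<kappa> \<inter> E4 \<mu> \<kappa> \<and>
         \<not> {Max B + 1..\<mu>} \<subseteq> A))"
proof -
  \<comment> \<open>Truncated subtraction would allow \<open>\<kappa> = 0\<close> with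
    \<open>\<mu> < 2\<close>; \<open>2 \<le> \<kappa>\<close> excludes this.\<close>
  have \<mu>: "\<kappa> + 2 \<le> \<mu>" and \<kappa>: "\<kappa> < \<mu>"
    using assms by auto
  have W: "(\<alpha>, add_coord j \<alpha> u) \<in> W \<mu> \<kappa>" if "source_at \<mu> \<kappa> j u \<alpha>" for \<alpha> j u
    using that unfolding W_eq[OF \<mu>] by blast
  have i: "((A, B), plus2 (A, B) (Max ({Max B + 1..\<mu>} - A))) \<in> W \<mu> \<kappa> \<inter> E1 \<mu> \<kappa>"
    if "(A, B) \<in> X \<mu> \<kappa>" "case_i \<mu> \<kappa> (A, B)" for A B
    using case_i_E1[OF \<kappa> that refl] W[of True "Max ({Max B + 1..\<mu>} - A)" "(A, B)"] that
    by (simp add: source_at_def)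
  have ii: "((A, B), plus1 (A, B) (Min B - 1)) \<in> W \<mu> \<kappa> \<inter> E2 \<mu> \<kappa>"
    if "(A, B) \<in> X \<mu> \<kappa>" "case_ii \<mu> \<kappa> (A, B)" for A B
    using case_ii_E2[OF \<kappa> that refl] W[of False "Min B - 1" "(A, B)"] that
    by (simp add: source_at_def)
  have iii: "((A, B), plus1 (A, B) \<mu>) \<in> W \<mu> \<kappa> \<inter> E3 \<mu> \<kappa> \<and> \<not> {Max B + 1..\<mu>} \<subseteq> A"
    if "(A, B) \<in> X \<mu> \<kappa>" "case_iii \<mu> \<kappa> (A, B)" for A B
    using case_iii_E3[OF \<kappa> that] W[of False \<mu> "(A, B)"] that
    by (simp add: source_at_def)
  have iv: "((A, B), plus1 (A, B) (Max ({1..Max B - 1} - B))) \<in> W \<mu> \<kappa> \<inter> E4 \<mu> \<kappa> \<and>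
      \<not> {Max B + 1..\<mu>} \<subseteq> A"
    if "(A, B) \<in> X \<mu> \<kappa>" "case_iv \<mu> \<kappa> (A, B)" for A B
    using case_iv_E4[OF \<kappa> that refl] W[of False "Max ({1..Max B - 1} - B)" "(A, B)"] that
    by (simp add: source_at_def)
  \<comment> \<open>One inclusion rests on the shape of the edges in the family, the other on each
    cell of the case having an edge in both \<open>W\<close> and the family.\<close>
  have red: "redundant_cells (W \<mu> \<kappa> \<inter> E) = {\<alpha> \<in> X \<mu> \<kappa>. P \<alpha>}"
    if "\<And>\<alpha> A B. (\<alpha>, (A, B)) \<in> E \<Longrightarrow> \<alpha> \<in> X \<mu> \<kappa> \<and> P \<alpha>"
      and "\<And>A B. (A, B) \<in> X \<mu> \<kappa> \<Longrightarrow> P (A, B) \<Longrightarrow> \<exists>\<beta>. ((A, B), \<beta>) \<in> W \<mu> \<kappa> \<inter> E" for E P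
    unfolding redundant_cells_def using that by auto
  have "redundant_cells (W \<mu> \<kappa> \<inter> E1 \<mu> \<kappa>) = {\<alpha> \<in> X \<mu> \<kappa>. case_i \<mu> \<kappa> \<alpha>}"
    using E1_case_i(2,3)[OF \<kappa>] i by (intro red) blast+
  moreover have "redundant_cells (W \<mu> \<kappa> \<inter> E2 \<mu> \<kappa>) = {\<alpha> \<in> X \<mu> \<kappa>. case_ii \<mu> \<kappa> \<alpha>}"
    using E2_case_ii(2,3)[OF \<kappa>] ii by (intro red) blast+
  moreover have "redundant_cells (W \<mu> \<kappa> \<inter> E3 \<mu> \<kappa>) = {\<alpha> \<in> X \<mu> \<kappa>. case_iii \<mu> \<kappa> \<alpha>}"
    using E3_case_iii(2,3)[OF \<kappa>] iii by (intro red) blast+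
  moreover have "redundant_cells (W \<mu> \<kappa> \<inter> E4 \<mu> \<kappa>) = {\<alpha> \<in> X \<mu> \<kappa>. case_iv \<mu> \<kappa> \<alpha>}"
    using E4_case_iv(2,3)[OF \<kappa> _ refl] iv by (intro red) blast+
  ultimately show ?thesis
    using i ii iii iv by simp
qed

end
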